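(* For every diagram $(G,l)$, $G=(V,E)$, over a monoid $M$, the Core Algorithm run on $(G,l)$ performs no more than $$|E'|\cdot\min(|V|,|E'|+1)+|E|\le\min(|V|^2,|E|)\cdot\min(|V|,|E|+1)+|E|$$ equality checks in $M$, where $E'$ denotes the set of edges of $G$ remaining after removing loops and multiple edges.
   Context: An oriented graph $G=(V,E)$ is a pair of finite nonempty sets (vertices and edges) with functions $t,o:E\to V$ giving the tail (end point) $t(e)$ and origin (starting point) $o(e)$ of each edge; loops and multiple edges are allowed. A diagram $(G,l)$ over a monoid $M$ is an oriented graph with a labeling $l:E\to M$. The set $E'\subseteq E$ is obtained from $E$ by deleting all loops and keeping exactly one edge from each class of edges with the same origin and the same tail. Core Algorithm (input: a diagram $(G,l)$ over $M$; "exit" terminates the whole algorithm; each test of equality between two elements of $M$ counts as one equality check): 1. RemoveLoops: for each vertex $v$ and each edge $e$ with $o(e)=v$: if $t(e)=v$, then exit with False if $l(e)\ne\mathbf 1_M$, and otherwise remove $e$ from $G$. 2. RemoveMultipleEdges: for each vertex $v$: create an empty array $T$ indexed by $V$; for each remaining edge $e$ with $o(e)=v$: if $T[t(e)]$ is empty, set $T[t(e)]=l(e)$; otherwise exit with False if $l(e)\neq T[t(e)]$, and else remove $e$ from $G$. 3. For each vertex $v\in V$: mark all vertices as not visited, set $m(w)=\mathbf 1_M$ for all $w\in V$, and run DFS$(G,v)$. 4. Exit with True. DFS$(G,v)$: mark $v$ as visited; for each remaining edge $e$ with $o(e)=v$, let $u=t(e)$; if $u$ is not visited, call ProceedNewVertex$(v,e,u)$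 and then DFS$(G,u)$; otherwise call ProceedOldVertex$(v,e,u)$. ProceedNewVertex$(v,e,u)$: set $m(u)=m(v)l(e)$ (one multiplication). ProceedOldVertex$(v,e,u)$: if $m(u)\ne m(v)l(e)$, exit with False (one multiplication and one equality check). *)

theory Defs
  imports
    "HOL-Algebra.Group"
    "HOL-Library.Monad_Syntax"
    "Graph_Theory.Digraph"
begin

section \<open>Diagrams over a monoid\<close>

text \<open>
  Naming pitfall: here an edge \<open>e\<close> runs from \<open>tail G e\<close> to \<open>head G e\<close>.  In the usual notation
  for diagrams the starting point is the origin \<open>o(e)\<close> and the end point is called the tail
  \<open>t(e)\<close>; thus \<open>o(e) = tail G e\<close> and \<open>t(e) = head G e\<close>.  Loops and multiple arcs are allowed.
\<close>

locale diagram = fin_digraph G + monoid M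
  for G :: "('v, 'e) pre_digraph" and M :: "('a, 'm) monoid_scheme" +
  fixes l :: "'e \<Rightarrow> 'a"
  assumes verts_nonempty: "verts G \<noteq> {}"
    and arcs_nonempty: "arcs G \<noteq> {}"
    and label_closed: "l \<in> arcs G \<rightarrow> carrier M"

definition reduced_arcs :: "('v, 'e) pre_digraph \<Rightarrow> 'e set \<Rightarrow> bool" where
  "reduced_arcs G E' \<longleftrightarrow>
     E' \<subseteq> arcs G \<and>
     (\<forall>e\<in>E'. tail G e \<noteq> head G e) \<and>
     (\<forall>e\<in>arcs G. tail G e \<noteq> head G e \<longrightarrow> (\<exists>!e'. e' \<in> E' \<and> arc_to_ends G e' = arc_to_ends G e))"

section \<open>Computations that count equality checks\<close>

text \<open>
  In \<open>(r, n)\<close>, \<open>n\<close> is the number of equality checks performed, and \<open>r = None\<close> means that the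
  whole algorithm has been terminated by an exit with False.
\<close>

type_synonym 'x counted = "'x option \<times> nat"

definition return :: "'x \<Rightarrow> 'x counted" where
  "return x = (Some x, 0)"

definition bind :: "'x counted \<Rightarrow> ('x \<Rightarrow> 'y counted) \<Rightarrow> 'y counted" where
  "bind c f = (case c of
      (None, n) \<Rightarrow> (None, n)
    | (Some x, n) \<Rightarrow> (case f x of (r, k) \<Rightarrow> (r, n + k)))"

adhoc_overloading Monad_Syntax.bind \<rightleftharpoons> bind

lemma bind_cong [fundef_cong]:
  assumes "c = c'" and "\<And>x n. c' = (Some x, n) \<Longrightarrow> f x = f' x"
  shows "bind c f = bind c' f'"
  using assms by (auto simp: bind_def split: option.split prod.split)

definition check_eq :: "'a \<Rightarrow> 'a \<Rightarrow> unit counted" where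
  "check_eq x y = (if x = y then Some () else None, 1)"

primrec for_each :: "'x list \<Rightarrow> ('x \<Rightarrow> 's \<Rightarrow> 's counted) \<Rightarrow> 's \<Rightarrow> 's counted" where
  "for_each [] f s = return s"
| "for_each (x # xs) f s = do { s' \<leftarrow> f x s; for_each xs f s' }"

section \<open>The algorithm\<close>

text \<open>
  The order in which the loops of the algorithm run through vertices and edges is not prescribed.
  A schedule fixes all these orders: \<open>X_verts\<close> for the loops over all vertices, and \<open>X_arcs v\<close> for
  the loops over the edges starting in \<open>v\<close>; \<open>dfs_arcs S s v\<close> is the order used at \<open>v\<close> during the
  search started from \<open>s\<close> (which visits \<open>v\<close> at most once).  The lists contain all edges starting in
  \<open>v\<close>; edges that have been removed are skipped when a list is used.
\<close>

record ('v, 'e) schedule =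
  loop_verts :: "'v list"
  loop_arcs :: "'v \<Rightarrow> 'e list"
  mult_verts :: "'v list"
  mult_arcs :: "'v \<Rightarrow> 'e list"
  dfs_verts :: "'v list"
  dfs_arcs :: "'v \<Rightarrow> 'v \<Rightarrow> 'e list"

definition enumerates :: "'x list \<Rightarrow> 'x set \<Rightarrow> bool" where
  "enumerates xs A \<longleftrightarrow> distinct xs \<and> set xs = A"

locale scheduled_diagram = diagram G M l
  for G :: "('v, 'e) pre_digraph" and M :: "('a, 'm) monoid_scheme" and l :: "'e \<Rightarrow> 'a" +
  fixes S :: "('v, 'e) schedule"
  assumes enum_verts:
      "enumerates (loop_verts S) (verts G)"
      "enumerates (mult_verts S) (verts G)"
      "enumerates (dfs_verts S) (verts G)"
    and enum_arcs:
      "\<And>v. enumerates (loop_arcs S v) (out_arcs G v)"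
      "\<And>v. enumerates (mult_arcs S v) (out_arcs G v)"
      "\<And>s v. enumerates (dfs_arcs S s v) (out_arcs G v)"
begin

text \<open>Throughout, \<open>R\<close> is the set of the edges that have not been removed.\<close>

definition remove_loops :: "'e set \<Rightarrow> 'e set counted" where
  "remove_loops =
     for_each (loop_verts S) (\<lambda>v.
       for_each (loop_arcs S v) (\<lambda>e R.
         if head G e = v then do { check_eq (l e) \<one>\<^bsub>M\<^esub>; return (R - {e}) }
         else return R))"

definition remove_multiple_arcs :: "'e set \<Rightarrow> 'e set counted" where
  "remove_multiple_arcs =
     for_each (mult_verts S) (\<lambda>v R. do {
       (R', T) \<leftarrow> for_each (filter (\<lambda>e. e \<in> R) (mult_arcs S v)) (\<lambda>e (R, T).
           case T (head G e) of
             None \<Rightarrow> return (R, T(head G e \<mapsto> l e))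
           | Some a \<Rightarrow> do { check_eq (l e) a; return (R - {e}, T) })
         (R, Map.empty);
       return R'
     })"

text \<open>
  The state \<open>(X, m)\<close> of the search consists of the set \<open>X\<close> of visited vertices and the array \<open>m\<close>.
  The edge loop is a separate function \<open>dfs_loop\<close>; the parameters \<open>R\<close> and \<open>s\<close> (the start vertex)
  remain fixed.
\<close>

function (sequential)
  dfs :: "'e set \<Rightarrow> 'v \<Rightarrow> 'v \<Rightarrow> 'v set \<times> ('v \<Rightarrow> 'a) \<Rightarrow> ('v set \<times> ('v \<Rightarrow> 'a)) counted" and
  dfs_loop :: "'e set \<Rightarrow> 'v \<Rightarrow> 'v \<Rightarrow> 'e list \<Rightarrow> 'v set \<times> ('v \<Rightarrow> 'a) \<Rightarrow> ('v set \<times> ('v \<Rightarrow> 'a)) counted"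
where
  "dfs R s v (X, m) = dfs_loop R s v (filter (\<lambda>e. e \<in> R) (dfs_arcs S s v)) (insert v X, m)"
| "dfs_loop R s v [] (X, m) = return (X, m)"
| "dfs_loop R s v (e # es) (X, m) =
     (let u = head G e in
      if u \<notin> X then do {
        st \<leftarrow> dfs R s u (X, m(u := m v \<otimes>\<^bsub>M\<^esub> l e));
        dfs_loop R s v es st
      } else do {
        check_eq (m u) (m v \<otimes>\<^bsub>M\<^esub> l e);
        dfs_loop R s v es (X, m)
      })"
  by pat_completeness auto

lemma visited_mono:
  "dfs_dfs_loop_dom (Inl (R, s, v, st)) \<Longrightarrow> dfs R s v st = (Some st', n) \<Longrightarrow> fst st \<subseteq> fst st'"
  "dfs_dfs_loop_dom (Inr (R, s, v, es, st)) \<Longrightarrow> dfs_loop R s v es st = (Some st', n) \<Longrightarrow> fst st \<subseteq> fst st'"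
proof (induction arbitrary: st' n and st' n rule: dfs_dfs_loop.pinduct)
  case (1 R s v X m)
  then show ?case by (fastforce simp: dfs.psimps)
next
  case (2 R s v X m)
  then show ?case by (simp add: dfs_loop.psimps return_def)
next
  case (3 R s v e es X m)
  show ?case
  proof (cases "head G e \<in> X")
    case True
    then show ?thesis
      using 3
      by (fastforce simp: dfs_loop.psimps bind_def check_eq_def split: option.splits prod.splits if_splits)
  next
    case False
    from 3(1) 3(5) False obtain st1 n1 n2 where
      1: "dfs R s (head G e) (X, m(head G e := m v \<otimes>\<^bsub>M\<^esub> l e)) = (Some st1, n1)" and
      2: "dfs_loop R s v es st1 = (Some st', n2)"
      by (auto simp: dfs_loop.psimps bind_def Let_def split: option.splits prod.splits)
    from 3(2)[OF refl False 1] 3(3)[OF refl False 1 2] show ?thesis by auto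
  qed
qed

termination
proof (relation "measures
  [case_sum (\<lambda>(R, s, v, X, m). card (verts G - insert v X))
     (\<lambda>(R, s, v, es, X, m). card (verts G \<union> head G ` set es - X)),
   case_sum (\<lambda>(R, s, v, X, m). Suc (length (dfs_arcs S s v)))
     (\<lambda>(R, s, v, es, X, m). length es)]", goal_cases)
  case 1
  show ?case by simp
next
  case (2 R s v X m)
  have "verts G \<union> head G ` set (filter (\<lambda>e. e \<in> R) (dfs_arcs S s v)) = verts G"
    using enum_arcs(3)[of s v] by (auto simp: enumerates_def)
  moreover have "length (filter (\<lambda>e. e \<in> R) (dfs_arcs S s v)) < Suc (length (dfs_arcs S s v))"
    by (simp add: less_Suc_eq_le)
  ultimately show ?case by simp
next
  case (3 R s v e es X m u)
  have "card (verts G - insert u X) < card (verts G \<union> head G ` set (e # es) - X)"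
    by (rule psubset_card_mono) (use 3 in auto)
  then show ?case by simp
next
  case (4 R s v e es X m u st n)
  obtain X' m' where st: "st = (X', m')" by force
  have "X \<subseteq> X'" using visited_mono(1)[of R s u "(X, m(u := m v \<otimes>\<^bsub>M\<^esub> l e))"] 4 st by force
  then have "card (verts G \<union> head G ` set es - X') \<le> card (verts G \<union> head G ` set (e # es) - X)"
    by (intro card_mono) auto
  then show ?case by (auto simp: st)
next
  case (5 R s v e es X m u)
  have "card (verts G \<union> head G ` set es - X) \<le> card (verts G \<union> head G ` set (e # es) - X)"
    by (rule card_mono) auto
  then show ?case by auto
qed

text \<open>The result is the returned truth value together with the number of equality checks.\<close>

definition core_algorithm :: "bool \<times> nat" where
  "core_algorithm =
     (case do {
         R \<leftarrow> remove_loops (arcs G);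
         R' \<leftarrow> remove_multiple_arcs R;
         for_each (dfs_verts S) (\<lambda>v _. do { dfs R' v v ({}, \<lambda>_. \<one>\<^bsub>M\<^esub>); return () }) ()
       } of (r, n) \<Rightarrow> (r = Some (), n))"

end

lemma (in diagram) schedule_exists: "\<exists>S. scheduled_diagram G M l S"
proof -
  obtain vs where vs: "enumerates vs (verts G)"
    using finite_distinct_list[OF finite_verts] by (auto simp: enumerates_def)
  have "\<exists>es. enumerates es (out_arcs G v)" for v
    using finite_distinct_list[OF finite_out_arcs] by (auto simp: enumerates_def)
  then obtain es where es: "\<And>v. enumerates (es v) (out_arcs G v)"
    by metis
  have "scheduled_diagram G M l
      \<lparr>loop_verts = vs, loop_arcs = es, mult_verts = vs, mult_arcs = es,
       dfs_verts = vs, dfs_arcs = (\<lambda>_. es)\<rparr>"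
    by unfold_locales (simp_all add: vs es)
  then show ?thesis by blast
qed

end

theory Submission
  imports Defs
begin

text \<open>
  All equality checks are paid for out of a budget, by an amortised argument.

  In the two removal phases every successful check is followed by the removal of the edge that was
  checked, and a failing check ends the algorithm while that edge is still present.  Hence the
  number of remaining edges pays for these phases, and they use at most \<open>|E|\<close> checks together.
  The surviving edges are not loops and have pairwise distinct pairs of end points; such a set
  injects into \<open>E'\<close>, which contains an edge for each pair of end points of a non-loop
  (\<open>card_le_reduced_arcs\<close>).

  A search visits each vertex at most once, so it looks at each surviving edge at most once and
  makes at most one check there: at most \<open>|E'|\<close> checks (\<open>dfs_pays\<close>).  A search started in a vertex
  that no surviving edge leaves makes no check at all, and at most \<open>min(|V|, |E'|)\<close> vertices
  are the origin of a surviving edge.  This bounds the last phase.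
\<close>

section \<open>Counted computations with a budget\<close>

text \<open>
  A Hoare triple with credits: with \<open>p\<close> credits, \<open>c\<close> can pay for its equality checks, and if it
  returns \<open>x\<close>, then \<open>Q x\<close> holds and \<open>\<Phi> x\<close> credits are left for the rest of the algorithm.  After an
  exit there is no rest, so no credits need to be left.
\<close>

definition pays :: "'x counted \<Rightarrow> nat \<Rightarrow> ('x \<Rightarrow> nat) \<Rightarrow> ('x \<Rightarrow> bool) \<Rightarrow> bool" where
  "pays c p \<Phi> Q \<longleftrightarrow> (case c of (None, n) \<Rightarrow> n \<le> p | (Some x, n) \<Rightarrow> n + \<Phi> x \<le> p \<and> Q x)"

lemma pays_imp_snd_le: "pays c p \<Phi> Q \<Longrightarrow> snd c \<le> p"
  by (auto simp: pays_def split: prod.splits option.splits)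

lemma pays_weaken:
  assumes "pays c p \<Phi> Q" and "p \<le> p'" and "\<And>x. Q x \<Longrightarrow> \<Psi> x \<le> \<Phi> x" and "\<And>x. Q x \<Longrightarrow> P x"
  shows "pays c p' \<Psi> P"
  using assms by (fastforce simp: pays_def split: prod.splits option.splits)

lemma pays_frame: "pays c p \<Phi> Q \<Longrightarrow> pays c (p + k) (\<lambda>x. \<Phi> x + k) Q"
  by (auto simp: pays_def split: prod.splits option.splits)

lemma pays_return: "Q x \<Longrightarrow> \<Phi> x \<le> p \<Longrightarrow> pays (return x) p \<Phi> Q"
  by (simp add: pays_def return_def)

lemma pays_bind:
  assumes "pays c p \<Phi> Q" and "\<And>x n. c = (Some x, n) \<Longrightarrow> Q x \<Longrightarrow> pays (f x) (\<Phi> x) \<Psi> P"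
  shows "pays (bind c f) p \<Psi> P"
proof (cases c)
  case (Pair r n)
  show ?thesis
  proof (cases r)
    case None
    with assms(1) Pair show ?thesis by (simp add: pays_def bind_def)
  next
    case (Some x)
    with assms(1) Pair have "n + \<Phi> x \<le> p" and "Q x" by (auto simp: pays_def)
    with assms(2)[of x n] Some Pair show ?thesis
      by (fastforce simp: pays_def bind_def split: prod.splits option.splits)
  qed
qed

lemma pays_check_eq_bind:
  assumes "x = y \<Longrightarrow> pays k q \<Psi> P" and "q < p"
  shows "pays (bind (check_eq x y) (\<lambda>_. k)) p \<Psi> P"
  using assms by (auto simp: pays_def bind_def check_eq_def split: prod.splits option.splits)

text \<open>
  The elements still to be processed are an argument of the invariant and of the credits: an
  invariant can then say that they have not been touched yet, and each of them can carry its own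
  share of the credits.
\<close>

lemma pays_for_each:
  assumes "\<And>x xs s. I (x # xs) s \<Longrightarrow> pays (f x s) (\<Phi> (x # xs) s) (\<Phi> xs) (I xs)"
    and "I xs s"
  shows "pays (for_each xs f s) (\<Phi> xs s) (\<Phi> []) (I [])"
  using assms(2)
proof (induction xs arbitrary: s)
  case Nil
  then show ?case by (simp add: pays_return)
next
  case (Cons x xs)
  show ?case
    by (auto intro: pays_bind[OF assms(1)[OF Cons.prems]] Cons.IH)
qed

section \<open>Loop-free sets of edges without multiple edges\<close>

definition has_loop_in :: "('v, 'e) pre_digraph \<Rightarrow> 'e set \<Rightarrow> bool" where
  "has_loop_in G R \<longleftrightarrow> (\<exists>e\<in>R. tail G e = head G e)"

lemma card_le_reduced_arcs:
  assumes fin: "finite (arcs G)" and red: "reduced_arcs G E'"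
    and R: "R \<subseteq> arcs G" "\<not> has_loop_in G R" "inj_on (arc_to_ends G) R"
  shows "card R \<le> card E'"
proof -
  have "arc_to_ends G ` R \<subseteq> arc_to_ends G ` E'"
  proof
    fix p assume "p \<in> arc_to_ends G ` R"
    then obtain e where e: "e \<in> R" "p = arc_to_ends G e" by blast
    then have "e \<in> arcs G" "tail G e \<noteq> head G e"
      using R by (auto simp: has_loop_in_def)
    then obtain e' where "e' \<in> E'" "arc_to_ends G e' = arc_to_ends G e"
      using red unfolding reduced_arcs_def by blast
    with e show "p \<in> arc_to_ends G ` E'" by (metis imageI)
  qed
  moreover have "finite E'"
    using fin red finite_subset unfolding reduced_arcs_def by blast
  ultimately show ?thesis
    using card_image[OF R(3)] by (metis card_image_le card_mono finite_imageI le_trans)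
qed

lemma inj_on_reduced_arcs: "reduced_arcs G E' \<Longrightarrow> inj_on (arc_to_ends G) E'"
  unfolding reduced_arcs_def by (intro inj_onI) (metis subsetD)

context fin_digraph
begin

lemma card_reduced_arcs_le:
  assumes "reduced_arcs G E'"
  shows "card E' \<le> min ((card (verts G))\<^sup>2) (card (arcs G))"
proof -
  have sub: "E' \<subseteq> arcs G" using assms by (simp add: reduced_arcs_def)
  have "arc_to_ends G ` E' \<subseteq> verts G \<times> verts G"
    using sub by (auto simp: arc_to_ends_def)
  then have "card (arc_to_ends G ` E') \<le> card (verts G \<times> verts G)"
    by (intro card_mono) auto
  then have "card E' \<le> (card (verts G))\<^sup>2"
    by (simp add: card_image[OF inj_on_reduced_arcs[OF assms]] card_cartesian_product power2_eq_square)
  with sub show ?thesis by (simp add: card_mono)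
qed

end

section \<open>Removing loops and multiple edges\<close>

context scheduled_diagram
begin

lemma remove_loops_pays:
  "pays (remove_loops (arcs G)) (card (arcs G)) card (\<lambda>R. R \<subseteq> arcs G \<and> \<not> has_loop_in G R)"
proof -
  \<comment> \<open>Edges still to be looked at have not been removed yet; this is why each removal of an edge
    really decreases the number of remaining edges.\<close>
  define I where "I vs R \<longleftrightarrow> distinct vs \<and> R \<subseteq> arcs G \<and> {e \<in> arcs G. tail G e \<in> set vs} \<subseteq> R \<and>
    (\<forall>e\<in>R. tail G e = head G e \<longrightarrow> tail G e \<in> set vs)" for vs R
  have "pays (for_each (loop_verts S) (\<lambda>v.
       for_each (loop_arcs S v) (\<lambda>e R.
         if head G e = v then do { check_eq (l e) \<one>\<^bsub>M\<^esub>; return (R - {e}) }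
         else return R)) (arcs G)) (card (arcs G)) card (I [])"
  proof (rule pays_for_each[where I = I and \<Phi> = "\<lambda>_. card"])
    show "I (loop_verts S) (arcs G)"
      using enum_verts(1) by (auto simp: I_def enumerates_def)
  next
    fix v vs R assume Iv: "I (v # vs) R"
    define J where "J es R \<longleftrightarrow> distinct es \<and> R \<subseteq> arcs G \<and> set es \<subseteq> R \<and> set es \<subseteq> out_arcs G v \<and>
      {e \<in> arcs G. tail G e \<in> set vs} \<subseteq> R \<and>
      (\<forall>e\<in>R. tail G e = head G e \<longrightarrow> tail G e \<in> set vs \<or> e \<in> set es)" for es R
    have v: "v \<notin> set vs" "distinct vs" using Iv by (auto simp: I_def)
    have "pays (for_each (loop_arcs S v) (\<lambda>e R.
         if head G e = v then do { check_eq (l e) \<one>\<^bsub>M\<^esub>; return (R - {e}) }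
         else return R) R) (card R) card (J [])"
    proof (rule pays_for_each[where I = J and \<Phi> = "\<lambda>_. card"])
      show "J (loop_arcs S v) R"
        using Iv enum_arcs(1)[of v] by (auto simp: I_def J_def enumerates_def)
    next
      fix e es R assume J: "J (e # es) R"
      have "e \<in> R" "finite R"
        using J finite_subset[of R "arcs G"] by (auto simp: J_def)
      then have less: "card (R - {e}) < card R"
        by (rule card_Diff1_less[rotated])
      have "J es (R - {e})" using J v by (auto simp: J_def)
      moreover have "J es R" if "head G e \<noteq> v" using J that by (auto simp: J_def)
      ultimately show "pays (if head G e = v
          then do { check_eq (l e) \<one>\<^bsub>M\<^esub>; return (R - {e}) } else return R) (card R) card (J es)"
        using less by (auto intro!: pays_check_eq_bind pays_return)
    qed
    then show "pays (for_each (loop_arcs S v) (\<lambda>e R.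
         if head G e = v then do { check_eq (l e) \<one>\<^bsub>M\<^esub>; return (R - {e}) }
         else return R) R) (card R) card (I vs)"
      by (rule pays_weaken) (use v in \<open>auto simp: I_def J_def\<close>)
  qed
  then show ?thesis unfolding remove_loops_def
    by (rule pays_weaken) (auto simp: I_def has_loop_in_def)
qed

lemma remove_multiple_arcs_pays:
  assumes "R0 \<subseteq> arcs G"
  shows "pays (remove_multiple_arcs R0) (card R0) card
    (\<lambda>R. R \<subseteq> R0 \<and> inj_on (arc_to_ends G) R)"
proof -
  define I where "I vs R \<longleftrightarrow> R \<subseteq> R0 \<and>
    (\<forall>e\<in>R. \<forall>e'\<in>R. arc_to_ends G e = arc_to_ends G e' \<longrightarrow> e = e' \<or> tail G e \<in> set vs)" for vs R
  let ?step = "\<lambda>e (R, T). case T (head G e) of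
             None \<Rightarrow> return (R, T(head G e \<mapsto> l e))
           | Some a \<Rightarrow> do { check_eq (l e) a; return (R - {e}, T) }"
  have "pays (remove_multiple_arcs R0) (card R0) card (I [])"
    unfolding remove_multiple_arcs_def
  proof (rule pays_for_each[where I = I and \<Phi> = "\<lambda>_. card"])
    show "I (mult_verts S) R0"
      using enum_verts(2) assms by (auto simp: I_def enumerates_def)
  next
    fix v vs R assume Iv: "I (v # vs) R"
    \<comment> \<open>The last clause says that \<open>T\<close> has an entry for the head of each kept edge; the entry makes
      the algorithm remove every later parallel edge.\<close>
    define J where "J es = (\<lambda>(R, T :: 'v \<Rightarrow> 'a option). distinct es \<and> R \<subseteq> R0 \<and> set es \<subseteq> R \<and>
      set es \<subseteq> out_arcs G v \<and>
      (\<forall>e\<in>R. \<forall>e'\<in>R. arc_to_ends G e = arc_to_ends G e' \<longrightarrow>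
         e = e' \<or> tail G e \<in> set vs \<or> e \<in> set es \<or> e' \<in> set es) \<and>
      (\<forall>e\<in>R. tail G e = v \<longrightarrow> e \<notin> set es \<longrightarrow> T (head G e) \<noteq> None))" for es
    have "pays (for_each (filter (\<lambda>e. e \<in> R) (mult_arcs S v)) ?step (R, Map.empty))
      ((\<lambda>(R, T). card R) (R, Map.empty :: 'v \<Rightarrow> 'a option)) (\<lambda>(R, T). card R) (J [])"
    proof (rule pays_for_each[where I = J and \<Phi> = "\<lambda>_ (R, T). card R"])
      show "J (filter (\<lambda>e. e \<in> R) (mult_arcs S v)) (R, Map.empty)"
        using Iv assms enum_arcs(2)[of v]
        by (auto simp: I_def J_def enumerates_def arc_to_ends_def)
    next
      fix e es and st :: "'e set \<times> ('v \<Rightarrow> 'a option)"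
      assume J: "J (e # es) st"
      obtain R T where st: "st = (R, T)" by force
      have "e \<in> R" "finite R"
        using J finite_subset[of R "arcs G"] assms by (auto simp: J_def st)
      then have less: "card (R - {e}) < card R"
        by (rule card_Diff1_less[rotated])
      have "J es (R - {e}, T)" using J by (auto simp: J_def st)
      moreover have "J es (R, T(head G e \<mapsto> l e))" if new: "T (head G e) = None"
      proof -
        have entry: "T (head G c) \<noteq> None" if "c \<in> R" "tail G c = v" "c \<notin> set (e # es)" for c
          using J that unfolding J_def st by blast
        have tail: "tail G e = v" using J by (auto simp: J_def st)
        \<comment> \<open>A kept edge parallel to \<open>e\<close> would have left an entry for the head of \<open>e\<close>.\<close>
        have only: "c = e" if "c \<in> R" "c \<notin> set es" "arc_to_ends G c = arc_to_ends G e" for c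
          using entry[of c] that tail new by (auto simp: arc_to_ends_def)
        have "a = b \<or> tail G a \<in> set vs \<or> a \<in> set es \<or> b \<in> set es"
          if ab: "a \<in> R" "b \<in> R" "arc_to_ends G a = arc_to_ends G b" for a b
        proof -
          have "a = b \<or> tail G a \<in> set vs \<or> a \<in> set (e # es) \<or> b \<in> set (e # es)"
            using J ab unfolding J_def st by blast
          then show ?thesis using only[of a] only[of b] ab by auto
        qed
        moreover have "(T(head G e \<mapsto> l e)) (head G c) \<noteq> None"
          if "c \<in> R" "tail G c = v" "c \<notin> set es" for c
          using entry[of c] that by auto
        moreover have "distinct es \<and> R \<subseteq> R0 \<and> set es \<subseteq> R \<and> set es \<subseteq> out_arcs G v"
          using J by (auto simp: J_def st)
        ultimately show ?thesis unfolding J_def by blast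
      qed
      ultimately show "pays (?step e st) (case st of (R, T) \<Rightarrow> card R) (\<lambda>(R, T). card R) (J es)"
        using less by (auto simp: st split: option.split intro!: pays_check_eq_bind pays_return)
    qed
    then show "pays (do {
       (R', T) \<leftarrow> for_each (filter (\<lambda>e. e \<in> R) (mult_arcs S v)) ?step (R, Map.empty);
       return R' }) (card R) card (I vs)"
      by (simp only: prod.case, elim pays_bind) (auto simp: I_def J_def intro!: pays_return)
  qed
  then show ?thesis
    by (rule pays_weaken) (auto simp: I_def inj_on_def)
qed

section \<open>The depth-first searches\<close>

definition unexplored :: "'e set \<Rightarrow> 'v set \<Rightarrow> 'e set" where
  "unexplored R X = {e \<in> R. tail G e \<notin> X}"

text \<open>
  The edges that leave unvisited vertices pay for the rest of a search.  When a vertex is visited,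
  the credits of its outgoing edges are handed to its edge loop, which uses up at most one for each
  edge: the credit of an edge to an unvisited vertex is not even spent, since no check is made.
\<close>

lemma dfs_pays:
  assumes "R \<subseteq> arcs G"
  shows "v \<notin> fst st \<Longrightarrow> pays (dfs R s v st) (card (unexplored R (fst st)))
           (\<lambda>st'. card (unexplored R (fst st'))) (\<lambda>_. True)"
    and "pays (dfs_loop R s v es st) (length es + card (unexplored R (fst st)))
           (\<lambda>st'. card (unexplored R (fst st'))) (\<lambda>_. True)"
  using assms
proof (induction R s v st and R s v es st rule: dfs_dfs_loop.induct)
  case (1 R s v X m)
  let ?es = "filter (\<lambda>e. e \<in> R) (dfs_arcs S s v)"
  have fin: "finite R" using finite_subset[OF 1(3)] by simp
  have es: "distinct ?es" "set ?es = {e \<in> R. tail G e = v}"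
    using enum_arcs(3)[of s v] 1(3) by (auto simp: enumerates_def)
  have "length ?es + card (unexplored R (insert v X)) =
      card ({e \<in> R. tail G e = v} \<union> unexplored R (insert v X))"
    using fin distinct_card[OF es(1)] es(2)
    by (subst card_Un_disjoint) (auto simp: unexplored_def)
  also have "{e \<in> R. tail G e = v} \<union> unexplored R (insert v X) = unexplored R X"
    using 1(2) by (auto simp: unexplored_def)
  finally show ?case using 1(1,3) by simp
next
  case (2 R s v X m)
  then show ?case by (simp add: pays_return)
next
  case (3 R s v e es X m)
  show ?case
  proof (cases "head G e \<in> X")
    case True
    have "pays (dfs_loop R s v es (X, m)) (length es + card (unexplored R X))
        (\<lambda>st'. card (unexplored R (fst st'))) (\<lambda>_. True)"
      if "m (head G e) = m v \<otimes>\<^bsub>M\<^esub> l e"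
      using 3(3)[OF refl, of "()" 1] 3(4) True that by (simp add: check_eq_def)
    with True show ?thesis by (auto intro: pays_check_eq_bind)
  next
    case False
    let ?st = "(X, m(head G e := m v \<otimes>\<^bsub>M\<^esub> l e))"
    have "pays (do { st' \<leftarrow> dfs R s (head G e) ?st; dfs_loop R s v es st' })
        (card (unexplored R X) + length es) (\<lambda>st'. card (unexplored R (fst st'))) (\<lambda>_. True)"
    proof (rule pays_bind[OF pays_frame])
      show "pays (dfs R s (head G e) ?st) (card (unexplored R X))
          (\<lambda>st'. card (unexplored R (fst st'))) (\<lambda>_. True)"
        using 3(1)[OF refl] False 3(4) by simp
    next
      fix st' n assume "dfs R s (head G e) ?st = (Some st', n)"
      from 3(2)[OF refl False this 3(4)]
      show "pays (dfs_loop R s v es st') (card (unexplored R (fst st')) + length es)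
          (\<lambda>st'. card (unexplored R (fst st'))) (\<lambda>_. True)"
        by (simp add: add.commute)
    qed
    then have "pays (dfs_loop R s v (e # es) (X, m)) (card (unexplored R X) + length es)
        (\<lambda>st'. card (unexplored R (fst st'))) (\<lambda>_. True)"
      using False by (simp add: Let_def)
    then show ?thesis by (rule pays_weaken) auto
  qed
qed

lemma dfs_from_sink:
  assumes "v \<notin> tail G ` R"
  shows "dfs R s v (X, m) = return (insert v X, m)"
proof -
  have "filter (\<lambda>e. e \<in> R) (dfs_arcs S s v) = []"
    using assms enum_arcs(3)[of s v] by (auto simp: enumerates_def filter_empty_conv)
  then show ?thesis by simp
qed

text \<open>
  Each start vertex that is the origin of a remaining edge owns \<open>card R\<close> credits, the others own
  none.  These origins number at most \<open>card R\<close>, because each of them has an edge of its own.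
\<close>

lemma searches_pay:
  assumes "R \<subseteq> arcs G"
  shows "pays (for_each (dfs_verts S) (\<lambda>v _. do { dfs R v v ({}, \<lambda>_. \<one>\<^bsub>M\<^esub>); return () }) ())
    (card R * min (card (verts G)) (card R)) (\<lambda>_. 0) (\<lambda>_. True)"
proof -
  have fin: "finite R" using finite_subset[OF assms] by simp
  let ?origins = "\<lambda>vs. set vs \<inter> tail G ` R"
  have "pays (for_each (dfs_verts S) (\<lambda>v _. do { dfs R v v ({}, \<lambda>_. \<one>\<^bsub>M\<^esub>); return () }) ())
    (card R * card (?origins (dfs_verts S))) (\<lambda>_. card R * card (?origins [])) (\<lambda>_. distinct ([] :: 'v list))"
  proof (rule pays_for_each[where I = "\<lambda>vs _. distinct vs"
        and \<Phi> = "\<lambda>vs _. card R * card (?origins vs)"])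
    show "distinct (dfs_verts S)" using enum_verts(3) by (simp add: enumerates_def)
  next
    fix v :: 'v and vs and u :: unit
    assume dist: "distinct (v # vs)"
    show "pays (do { dfs R v v ({}, \<lambda>_. \<one>\<^bsub>M\<^esub>); return () }) (card R * card (?origins (v # vs)))
      (\<lambda>_. card R * card (?origins vs)) (\<lambda>_. distinct vs)"
    proof (cases "v \<in> tail G ` R")
      case False
      then show ?thesis using dist
        by (simp add: dfs_from_sink bind_def return_def pays_def del: dfs.simps)
    next
      case True
      then have "card (?origins (v # vs)) = Suc (card (?origins vs))"
        using dist by simp
      moreover have "pays (dfs R v v ({}, \<lambda>_. \<one>\<^bsub>M\<^esub>)) (card R + card R * card (?origins vs))
          (\<lambda>_. card R * card (?origins vs)) (\<lambda>_. True)"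
        using pays_frame[where k = "card R * card (?origins vs)",
            OF dfs_pays(1)[OF assms, of v "({}, \<lambda>_. \<one>\<^bsub>M\<^esub>)" v]]
        by (rule pays_weaken) (auto simp: unexplored_def)
      ultimately show ?thesis using dist
        by (auto intro!: pays_bind pays_return)
    qed
  qed
  moreover have "card (?origins (dfs_verts S)) \<le> min (card (verts G)) (card R)"
  proof -
    have "card (?origins (dfs_verts S)) \<le> card (verts G)"
      using enum_verts(3) by (intro card_mono) (auto simp: enumerates_def)
    moreover have "card (?origins (dfs_verts S)) \<le> card (tail G ` R)"
      using fin by (intro card_mono) auto
    ultimately show ?thesis using card_image_le[OF fin, of "tail G"] by linarith
  qed
  ultimately show ?thesis
    by (elim pays_weaken) auto
qed

section \<open>The number of equality checks\<close>

lemma core_algorithm_checks: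
  assumes "reduced_arcs G E'"
  shows "snd core_algorithm \<le> card E' * min (card (verts G)) (card E') + card (arcs G)"
proof -
  let ?k = "card E' * min (card (verts G)) (card E')"
  \<comment> \<open>The searches use the reserve of \<open>?k\<close> credits, which is carried unspent through the removal
    phases.\<close>
  have "pays (do {
         R \<leftarrow> remove_loops (arcs G);
         R' \<leftarrow> remove_multiple_arcs R;
         for_each (dfs_verts S) (\<lambda>v _. do { dfs R' v v ({}, \<lambda>_. \<one>\<^bsub>M\<^esub>); return () }) ()
       }) (card (arcs G) + ?k) (\<lambda>_. 0) (\<lambda>_. True)"
  proof (rule pays_bind[OF pays_frame[OF remove_loops_pays]])
    fix R assume R: "R \<subseteq> arcs G \<and> \<not> has_loop_in G R"
    show "pays (do {
         R' \<leftarrow> remove_multiple_arcs R;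
         for_each (dfs_verts S) (\<lambda>v _. do { dfs R' v v ({}, \<lambda>_. \<one>\<^bsub>M\<^esub>); return () }) ()
       }) (card R + ?k) (\<lambda>_. 0) (\<lambda>_. True)"
    proof (rule pays_bind[OF pays_frame[OF remove_multiple_arcs_pays]])
      fix R' assume R': "R' \<subseteq> R \<and> inj_on (arc_to_ends G) R'"
      then have sub: "R' \<subseteq> arcs G" and "\<not> has_loop_in G R'"
        using R by (auto simp: has_loop_in_def)
      then have "card R' \<le> card E'"
        using card_le_reduced_arcs[OF _ assms] R' by simp
      then have "card R' * min (card (verts G)) (card R') \<le> ?k"
        by (intro mult_le_mono) auto
      then show "pays (for_each (dfs_verts S) (\<lambda>v _. do { dfs R' v v ({}, \<lambda>_. \<one>\<^bsub>M\<^esub>); return () }) ())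
          (card R' + ?k) (\<lambda>_. 0) (\<lambda>_. True)"
        by (intro pays_weaken[OF searches_pay[OF sub]]) auto
    qed (use R in blast)
  qed
  then show ?thesis
    using pays_imp_snd_le unfolding core_algorithm_def by (fastforce split: prod.splits)
qed

end

theorem theorem7p3:
  fixes G :: "('v, 'e) pre_digraph" and M :: "('a, 'm) monoid_scheme" and l :: "'e \<Rightarrow> 'a"
    and S :: "('v, 'e) schedule" and E' :: "'e set"
  assumes "diagram G M l"
    and "scheduled_diagram G M l S"
    and "reduced_arcs G E'"
  shows "snd (scheduled_diagram.core_algorithm G M l S)
           \<le> card E' * min (card (verts G)) (card E' + 1) + card (arcs G)
       \<and> card E' * min (card (verts G)) (card E' + 1) + card (arcs G)
           \<le> min ((card (verts G))\<^sup>2) (card (arcs G)) * min (card (verts G)) (card (arcs G) + 1)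
             + card (arcs G)"
proof -
  interpret scheduled_diagram G M l S by (fact assms(2))
  have "card E' * min (card (verts G)) (card E') \<le> card E' * min (card (verts G)) (card E' + 1)"
    by (intro mult_le_mono) auto
  moreover have "card E' * min (card (verts G)) (card E' + 1)
      \<le> min ((card (verts G))\<^sup>2) (card (arcs G)) * min (card (verts G)) (card (arcs G) + 1)"
    using card_reduced_arcs_le[OF assms(3)] by (intro mult_le_mono) auto
  ultimately show ?thesis
    using core_algorithm_checks[OF assms(3)] by linarith
qed

end
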